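(* Let $m,n$ be positive integers, and let $(X_1,\dots,X_m,A)$ and $(Y_1,\dots,Y_n,B)$ be independent random vectors (with values in $\mathbb{R}^{m+1}$ and $\mathbb{R}^{n+1}$ respectively), where $X_i$ and $Y_j$ are nondegenerate for all $i\in\{1,\dots,m\}$ and $j\in\{1,\dots,n\}$. Suppose that the statistic $$\sum_{i=1}^m a_iX_i+\sum_{j=1}^n b_jY_j+A+B$$ has a distribution which depends only on $\|a\|^2+\|b\|^2$, where $a=(a_1,\dots,a_m)\in\mathbb{R}^m$ and $b=(b_1,\dots,b_n)\in\mathbb{R}^n$. Then the random variables $X_1,\dots,X_m,Y_1,\dots,Y_n$ are independent and have the same normal distribution with zero means.
   Context: $\|\cdot\|$ denotes the Euclidean norm. A real random variable is nondegenerate if it is not almost surely constant. Independence of the two random vectors $(X_1,\dots,X_m,A)$ and $(Y_1,\dots,Y_n,B)$ means independence of one vector from the other; no independence among the components of a single vector is assumed, and no moment assumptions are made. "The distribution depends only on $\|a\|^2+\|b\|^2$" means: whenever $(a,b),(a',b')\in\mathbb{R}^m\times\mathbb{R}^n$ satisfy $\|a\|^2+\|b\|^2=\|a'\|^2+\|b'\|^2$, the random variables $\sum_i a_iX_i+\sum_j b_jY_j+A+B$ and $\sum_i a'_iX_i+\sum_j b'_jY_j+A+B$ have the same distribution. In the conclusion, "independent" means that all $m+n$ random variables are mutually independent. *)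

theory Defs
  imports "HOL-Probability.Probability"
begin

text \<open>The library constant \<^const>\<open>prob_space.indep_var\<close> only relates random variables with
  the same value type; random vectors of different dimensions need the version below.\<close>

definition indep_rv ::
  "'w measure \<Rightarrow> 'b measure \<Rightarrow> ('w \<Rightarrow> 'b) \<Rightarrow> 'c measure \<Rightarrow> ('w \<Rightarrow> 'c) \<Rightarrow> bool" where
  "indep_rv M N\<^sub>1 U N\<^sub>2 V \<longleftrightarrow>
     U \<in> measurable M N\<^sub>1 \<and> V \<in> measurable M N\<^sub>2 \<and>
     prob_space.indep_set M
       {U -` S \<inter> space M | S. S \<in> sets N\<^sub>1} {V -` S \<inter> space M | S. S \<in> sets N\<^sub>2}"

lemma (in prob_space) indep_rv_iff_indep_var:
  "indep_rv M N\<^sub>1 U N\<^sub>2 V \<longleftrightarrow> indep_var N\<^sub>1 U N\<^sub>2 V"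
proof -
  have "(\<lambda>b. {case_bool U V b -` S \<inter> space M | S. S \<in> sets (case_bool N\<^sub>1 N\<^sub>2 b)}) =
    case_bool {U -` S \<inter> space M | S. S \<in> sets N\<^sub>1} {V -` S \<inter> space M | S. S \<in> sets N\<^sub>2}"
    by (rule ext) (simp split: bool.split)
  then show ?thesis
    unfolding indep_rv_def indep_var_def indep_vars_def2 indep_set_def
    by (auto simp: UNIV_bool)
qed

definition nondegenerate :: "'w measure \<Rightarrow> ('w \<Rightarrow> real) \<Rightarrow> bool" where
  "nondegenerate M Z \<longleftrightarrow> \<not> (\<exists>c. AE \<omega> in M. Z \<omega> = c)"

definition statistic ::
  "('w \<Rightarrow> real ^ 'm) \<Rightarrow> ('w \<Rightarrow> real) \<Rightarrow> ('w \<Rightarrow> real ^ 'n) \<Rightarrow> ('w \<Rightarrow> real)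
    \<Rightarrow> real ^ 'm \<Rightarrow> real ^ 'n \<Rightarrow> 'w \<Rightarrow> real" where
  "statistic X A Y B a b \<omega> =
     (\<Sum>i\<in>UNIV. a $ i * X \<omega> $ i) + (\<Sum>j\<in>UNIV. b $ j * Y \<omega> $ j) + A \<omega> + B \<omega>"

end

theory Submission
  imports Defs
begin

text \<open>Everything is read off characteristic functions. Put \<open>a = s / \<epsilon>\<close> and \<open>b = r / \<epsilon>\<close> and
  evaluate the characteristic function of the statistic at \<open>\<epsilon>\<close>: this is the characteristic
  function at 1 of \<open>s \<bullet> X + r \<bullet> Y + \<epsilon> (A + B)\<close>, and by hypothesis it depends on \<open>s\<close> and \<open>r\<close> only
  through \<open>\<parallel>s\<parallel>\<^sup>2 + \<parallel>r\<parallel>\<^sup>2\<close>. Letting \<open>\<epsilon>\<close> tend to 0 removes the shift \<open>A + B\<close>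
  (\<open>char_linear_part_radial\<close>), so the joint characteristic function \<open>\<Psi> s r\<close> of \<open>X\<close> and \<open>Y\<close>
  is radial on the product space.

  Let \<open>\<phi>\<close> be the characteristic function of one component of \<open>X\<close>. Radiality gives
  \<open>\<Psi> s r = \<phi> (sqrt (\<parallel>s\<parallel>\<^sup>2 + \<parallel>r\<parallel>\<^sup>2))\<close>, and independence of the two vectors splits
  \<open>\<Psi> s r\<close> into a factor for \<open>X\<close> and a factor for \<open>Y\<close>. Together they yield the functional equation
  \<open>\<phi> (sqrt (x\<^sup>2 + y\<^sup>2)) = \<phi> x * \<phi> y\<close>, the one by which Maxwell and Herschel derived the
  normal law; its only solutions among characteristic functions are \<open>exp (- c * x\<^sup>2)\<close> with \<open>c \<ge> 0\<close>
  (\<open>Maxwell_Herschel\<close>). Nondegeneracy excludes \<open>c = 0\<close>.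

  Hence \<open>\<Psi> s r = exp (- c * (\<parallel>s\<parallel>\<^sup>2 + \<parallel>r\<parallel>\<^sup>2))\<close>, which is the product of the
  characteristic functions of all the components. Kac's criterion (\<open>Kac_indep_vars\<close>) turns this
  factorization into mutual independence. It is derived from uniqueness in one dimension, one
  variable at a time.\<close>

section \<open>Kac's criterion for independence\<close>

lemma (in prob_space) char_distr_eq:
  assumes "random_variable borel Z"
  shows "char (distr M borel Z) t = expectation (\<lambda>\<omega>. iexp (t * Z \<omega>))"
  using assms unfolding char_def by (subst integral_distr) auto

lemma cnj_char: "cnj (char M t) = char M (- t)"
  unfolding char_def Bochner_Integration.integral_cnj[symmetric]
  by (simp add: exp_cnj del: Bochner_Integration.integral_cnj)

text \<open>If the weight \<open>W\<close> is uncorrelated with every exponential of \<open>Z\<close>, it is uncorrelated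
  with every event of \<open>Z\<close>. Adding a constant makes the weight positive without affecting the
  hypothesis, and after normalization it is a probability density. Under the reweighted measure
  \<open>Z\<close> has the same characteristic function as before, hence the same law.\<close>

lemma (in prob_space) real_weight_uncorrelated:
  fixes W Z :: "'a \<Rightarrow> real"
  assumes Z[measurable]: "random_variable borel Z"
    and W[measurable]: "random_variable borel W" and bd: "\<And>\<omega>. \<bar>W \<omega>\<bar> \<le> C"
    and fac: "\<And>s. expectation (\<lambda>\<omega>. of_real (W \<omega>) * iexp (s * Z \<omega>))
                = of_real (expectation W) * char (distr M borel Z) s"
    and S[measurable]: "S \<in> sets borel"
  shows "expectation (\<lambda>\<omega>. W \<omega> * indicator S (Z \<omega>)) = expectation W * prob (Z -` S \<inter> space M)"
proof -
  \<comment> \<open>The 1 keeps the normalizing constant away from 0.\<close>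
  define V where "V \<omega> = W \<omega> + (C + 1)" for \<omega>
  define c where "c = expectation W + (C + 1)"
  define D where "D = density M (\<lambda>\<omega>. ennreal (V \<omega> / c))"
  have [measurable]: "V \<in> borel_measurable M" by (simp add: V_def[abs_def])
  have intW: "integrable M W"
    by (rule integrable_const_bound[where B=C]) (use bd in auto)
  have intV: "integrable M V" using intW by (simp add: V_def[abs_def])
  have cV: "c = expectation V" using intW by (simp add: V_def[abs_def] c_def prob_space)
  have V1: "V \<omega> \<ge> 1" for \<omega> using bd[of \<omega>] by (simp add: V_def)
  have "(\<integral>\<omega>. 1 \<partial>M) \<le> expectation V"
    by (rule integral_mono) (use intV V1 in auto)
  then have c1: "c \<ge> 1" by (simp add: cV prob_space)
  have V0: "0 \<le> V \<omega> / c" for \<omega> using V1[of \<omega>] c1 by simp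
  have "(\<integral>\<^sup>+ \<omega>. ennreal (V \<omega> / c) \<partial>M) = ennreal (expectation (\<lambda>\<omega>. V \<omega> / c))"
    by (rule nn_integral_eq_integral) (use intV V0 in auto)
  also have "\<dots> = 1" using c1 by (simp add: cV)
  finally have "emeasure D (space D) = 1" by (simp add: D_def emeasure_density cong: nn_integral_cong)
  then interpret D: prob_space D by (rule prob_spaceI)
  have ZD[measurable]: "Z \<in> borel_measurable D" by (simp add: D_def)
  have intI: "integrable M (\<lambda>\<omega>. iexp (s * Z \<omega>))" for s
    by (rule integrable_const_bound[where B=1]) (auto simp del: of_real_mult)
  have intWI: "integrable M (\<lambda>\<omega>. of_real (W \<omega>) * iexp (s * Z \<omega>))" for s
    by (rule integrable_const_bound[where B=C])
      (use bd in \<open>auto simp: norm_mult simp del: of_real_mult\<close>)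
  have "char (distr D borel Z) = char (distr M borel Z)"
  proof
    fix s
    have "char (distr D borel Z) s = expectation (\<lambda>\<omega>. (V \<omega> / c) *\<^sub>R iexp (s * Z \<omega>))"
      unfolding D.char_distr_eq[OF ZD] unfolding D_def
      by (rule integral_density) (use V0 in auto)
    also have "\<dots> = expectation (\<lambda>\<omega>. (of_real (W \<omega>) * iexp (s * Z \<omega>) + of_real (C + 1) * iexp (s * Z \<omega>)) / of_real c)"
      by (rule Bochner_Integration.integral_cong) (auto simp: V_def scaleR_conv_of_real field_simps)
    also have "\<dots> = (of_real (expectation W) * char (distr M borel Z) s
        + of_real (C + 1) * char (distr M borel Z) s) / of_real c"
      using intI[of s] intWI[of s]
      by (simp add: fac char_distr_eq[OF Z] del: of_real_mult of_real_add)
    also have "\<dots> = char (distr M borel Z) s"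
    proof -
      have "of_real (expectation W) * char (distr M borel Z) s + of_real (C + 1) * char (distr M borel Z) s
        = of_real c * char (distr M borel Z) s"
        by (simp add: c_def algebra_simps)
      then show ?thesis using c1 by simp
    qed
    finally show "char (distr D borel Z) s = char (distr M borel Z) s" .
  qed
  then have "distr D borel Z = distr M borel Z"
    by (intro Levy_uniqueness D.real_distribution_distr real_distribution_distr) auto
  then have "(\<integral>z. indicator S z \<partial>distr D borel Z) = (\<integral>z. indicator S z \<partial>distr M borel Z :: real)"
    by simp
  then have "expectation (\<lambda>\<omega>. (V \<omega> / c) * indicator S (Z \<omega>)) = prob (Z -` S \<inter> space M)"
    by (subst (asm) integral_distr, simp, simp)
      (simp add: D_def integral_density V0 measure_distr)
  then have VS: "expectation (\<lambda>\<omega>. V \<omega> * indicator S (Z \<omega>)) = c * prob (Z -` S \<inter> space M)"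
    using c1 by (simp add: field_simps)
  have intS: "integrable M (\<lambda>\<omega>. indicator S (Z \<omega>) :: real)"
    by (rule integrable_const_bound[where B=1]) (auto simp: indicator_def)
  have intWS: "integrable M (\<lambda>\<omega>. W \<omega> * indicator S (Z \<omega>))"
    by (rule integrable_const_bound[where B=C])
      (use bd order_trans[OF abs_ge_zero bd] in \<open>auto simp: indicator_def\<close>)
  have PS: "expectation (\<lambda>\<omega>. indicator S (Z \<omega>) :: real) = prob (Z -` S \<inter> space M)"
    using integral_distr[OF Z, of "indicator S :: real \<Rightarrow> real"] by (simp add: measure_distr)
  have "expectation (\<lambda>\<omega>. V \<omega> * indicator S (Z \<omega>))
      = expectation (\<lambda>\<omega>. W \<omega> * indicator S (Z \<omega>)) + (C + 1) * prob (Z -` S \<inter> space M)"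
    using intS intWS by (simp add: V_def ring_distribs(2)[of "W _" "C + 1"] PS del: distrib_right)
  with VS show ?thesis by (simp add: c_def algebra_simps)
qed

text \<open>The hypothesis for \<open>W\<close> at \<open>- s\<close> is, after conjugation, the hypothesis for the conjugate
  of \<open>W\<close> at \<open>s\<close>; it therefore passes to the real part, which is half the sum of the two.\<close>

lemma (in prob_space) Re_weight_uncorrelated:
  fixes W :: "'a \<Rightarrow> complex" and Z :: "'a \<Rightarrow> real"
  assumes Z[measurable]: "random_variable borel Z"
    and W[measurable]: "W \<in> borel_measurable M" and bd: "\<And>\<omega>. cmod (W \<omega>) \<le> C"
    and fac: "\<And>s. expectation (\<lambda>\<omega>. W \<omega> * iexp (s * Z \<omega>))
                = expectation W * char (distr M borel Z) s"
    and S[measurable]: "S \<in> sets borel"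
  shows "expectation (\<lambda>\<omega>. Re (W \<omega>) * indicator S (Z \<omega>))
           = expectation (\<lambda>\<omega>. Re (W \<omega>)) * prob (Z -` S \<inter> space M)"
proof -
  let ?E = "\<lambda>f :: 'a \<Rightarrow> complex. expectation f"
  have intW: "integrable M W"
    by (rule integrable_const_bound[where B=C]) (use bd in auto)
  have intWI: "integrable M (\<lambda>\<omega>. W \<omega> * iexp (s * Z \<omega>))" for s
    by (rule integrable_const_bound[where B=C])
      (use bd in \<open>auto simp: norm_mult simp del: of_real_mult\<close>)
  have [measurable]: "(\<lambda>\<omega>. cnj (W \<omega>)) \<in> borel_measurable M"
    by (rule borel_measurable_continuous_on[OF _ W]) (intro continuous_intros)
  have intcWI: "integrable M (\<lambda>\<omega>. cnj (W \<omega>) * iexp (s * Z \<omega>))" for s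
    by (rule integrable_const_bound[where B=C])
      (use bd in \<open>auto simp: norm_mult simp del: of_real_mult\<close>)
  have cchar: "cnj (char (distr M borel Z) (- s)) = char (distr M borel Z) s" for s
    by (simp add: cnj_char)
  have cfac: "?E (\<lambda>\<omega>. cnj (W \<omega>) * iexp (s * Z \<omega>)) = cnj (?E W) * char (distr M borel Z) s" for s
  proof -
    have "?E (\<lambda>\<omega>. cnj (W \<omega>) * iexp (s * Z \<omega>)) = cnj (?E (\<lambda>\<omega>. W \<omega> * iexp (- s * Z \<omega>)))"
      unfolding Bochner_Integration.integral_cnj[symmetric] by (simp add: exp_cnj del: Bochner_Integration.integral_cnj)
    then show ?thesis using fac[of "- s"] cchar[of s] by simp
  qed
  show ?thesis
  proof (rule real_weight_uncorrelated[OF Z _ _ _ S])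
    show "\<bar>Re (W \<omega>)\<bar> \<le> C" for \<omega> using abs_Re_le_cmod bd order_trans by blast
    fix s
    have "?E (\<lambda>\<omega>. of_real (Re (W \<omega>)) * iexp (s * Z \<omega>))
        = ?E (\<lambda>\<omega>. (W \<omega> * iexp (s * Z \<omega>) + cnj (W \<omega>) * iexp (s * Z \<omega>)) / 2)"
      by (rule Bochner_Integration.integral_cong)
        (simp_all only: complex_add_cnj distrib_right[symmetric], simp)
    also have "\<dots> = (?E W + cnj (?E W)) / 2 * char (distr M borel Z) s"
      using intWI[of s] intcWI[of s] by (simp add: fac cfac distrib_right del: of_real_mult)
    also have "(?E W + cnj (?E W)) / 2 = of_real (expectation (\<lambda>\<omega>. Re (W \<omega>)))"
      using integral_Re[OF intW] by (simp add: complex_add_cnj)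
    finally show "?E (\<lambda>\<omega>. of_real (Re (W \<omega>)) * iexp (s * Z \<omega>))
        = of_real (expectation (\<lambda>\<omega>. Re (W \<omega>))) * char (distr M borel Z) s" .
  qed measurable
qed

lemma (in prob_space) complex_weight_uncorrelated:
  fixes W :: "'a \<Rightarrow> complex" and Z :: "'a \<Rightarrow> real"
  assumes Z[measurable]: "random_variable borel Z"
    and W[measurable]: "W \<in> borel_measurable M" and bd: "\<And>\<omega>. cmod (W \<omega>) \<le> C"
    and fac: "\<And>s. expectation (\<lambda>\<omega>. W \<omega> * iexp (s * Z \<omega>))
                = expectation W * char (distr M borel Z) s"
    and S[measurable]: "S \<in> sets borel"
  shows "expectation (\<lambda>\<omega>. W \<omega> * indicator S (Z \<omega>))
           = expectation W * of_real (prob (Z -` S \<inter> space M))"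
proof -
  have intW: "integrable M W"
    by (rule integrable_const_bound[where B=C]) (use bd in auto)
  have Re: "expectation (\<lambda>\<omega>. Re (W \<omega>) * indicator S (Z \<omega>))
      = expectation (\<lambda>\<omega>. Re (W \<omega>)) * prob (Z -` S \<inter> space M)"
    by (rule Re_weight_uncorrelated[OF Z W bd fac S])
  \<comment> \<open>The imaginary part of \<open>W\<close> is the real part of \<open>- \<i> * W\<close>.\<close>
  have "expectation (\<lambda>\<omega>. Re (- \<i> * W \<omega>) * indicator S (Z \<omega>))
      = expectation (\<lambda>\<omega>. Re (- \<i> * W \<omega>)) * prob (Z -` S \<inter> space M)"
  proof (rule Re_weight_uncorrelated[OF Z _ _ _ S])
    show "cmod (- \<i> * W \<omega>) \<le> C" for \<omega> using bd by (simp add: norm_mult)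
    show "expectation (\<lambda>\<omega>. - \<i> * W \<omega> * iexp (s * Z \<omega>))
        = expectation (\<lambda>\<omega>. - \<i> * W \<omega>) * char (distr M borel Z) s" for s
      unfolding mult.assoc integral_mult_right_zero fac by simp
  qed measurable
  then have Im: "expectation (\<lambda>\<omega>. Im (W \<omega>) * indicator S (Z \<omega>))
      = expectation (\<lambda>\<omega>. Im (W \<omega>)) * prob (Z -` S \<inter> space M)" by simp
  have intWS: "integrable M (\<lambda>\<omega>. W \<omega> * indicator S (Z \<omega>))"
    by (rule integrable_const_bound[where B=C])
      (use bd order_trans[OF norm_ge_zero bd] in \<open>auto simp: indicator_def\<close>)
  have ReI: "Re (W \<omega> * indicator S (Z \<omega>)) = Re (W \<omega>) * indicator S (Z \<omega>)"
    and ImI: "Im (W \<omega> * indicator S (Z \<omega>)) = Im (W \<omega>) * indicator S (Z \<omega>)" for \<omega>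
    by (auto simp: indicator_def)
  show ?thesis
  proof (rule complex_eqI)
    show "Re (expectation (\<lambda>\<omega>. W \<omega> * indicator S (Z \<omega>)))
        = Re (expectation W * of_real (prob (Z -` S \<inter> space M)))"
      unfolding integral_Re[OF intWS, symmetric] ReI Re integral_Re[OF intW] by simp
    show "Im (expectation (\<lambda>\<omega>. W \<omega> * indicator S (Z \<omega>)))
        = Im (expectation W * of_real (prob (Z -` S \<inter> space M)))"
      unfolding integral_Im[OF intWS, symmetric] ImI Im integral_Im[OF intW] by simp
  qed
qed

text \<open>The exponentials \<open>iexp (s i * Z i)\<close> in the factorization are exchanged for indicators of
  events \<open>Z i \<in> S i\<close> one index at a time. When index \<open>j\<close> is exchanged, the product over the other
  indices, a mixture of indicators and exponentials, serves as a bounded complex weight. Once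
  all indices are exchanged, the product formula for probabilities remains.\<close>

theorem (in prob_space) Kac_indep_vars:
  fixes Z :: "'i \<Rightarrow> 'a \<Rightarrow> real"
  assumes I: "finite I" "I \<noteq> {}"
    and Z: "\<And>i. i \<in> I \<Longrightarrow> random_variable borel (Z i)"
    and fac: "\<And>s. expectation (\<lambda>\<omega>. iexp (\<Sum>i\<in>I. s i * Z i \<omega>))
                = (\<Prod>i\<in>I. char (distr M borel (Z i)) (s i))"
  shows "indep_vars (\<lambda>_. borel) Z I"
proof -
  define F :: "'i set \<Rightarrow> ('i \<Rightarrow> real set) \<Rightarrow> ('i \<Rightarrow> real) \<Rightarrow> 'i \<Rightarrow> 'a \<Rightarrow> complex" where
    "F J S s i \<omega> = (if i \<in> J then indicator (S i) (Z i \<omega>) else iexp (s i * Z i \<omega>))" for J S s i \<omega>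
  define G :: "'i set \<Rightarrow> ('i \<Rightarrow> real set) \<Rightarrow> ('i \<Rightarrow> real) \<Rightarrow> 'i \<Rightarrow> complex" where
    "G J S s i = (if i \<in> J then of_real (prob (Z i -` S i \<inter> space M))
                  else char (distr M borel (Z i)) (s i))" for J S s i
  \<comment> \<open>\<open>J\<close> is the set of indices that have already been exchanged.\<close>
  have key: "expectation (\<lambda>\<omega>. \<Prod>i\<in>I. F J S s i \<omega>) = (\<Prod>i\<in>I. G J S s i)"
    if "J \<subseteq> I" "\<And>i. i \<in> I \<Longrightarrow> S i \<in> sets borel" for J S s
    using finite_subset[OF that(1) I(1)] that(1)
  proof (induction J arbitrary: s rule: finite_induct)
    case empty
    then show ?case
      using fac[of s] I(1) by (simp add: F_def G_def sum_distrib_left exp_sum)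
  next
    case (insert j J)
    from insert.prems have j: "j \<in> I" and J: "J \<subseteq> I" by auto
    define W where "W \<omega> = (\<Prod>i\<in>I - {j}. F J S s i \<omega>)" for \<omega>
    define K where "K = (\<Prod>i\<in>I - {j}. G J S s i)"
    have Fm: "F J S s i \<in> borel_measurable M" if "i \<in> I" for i
    proof -
      note [measurable] = Z[OF that] \<open>\<And>i. i \<in> I \<Longrightarrow> S i \<in> sets borel\<close>[OF that]
      show ?thesis unfolding F_def[abs_def] by measurable
    qed
    have Wm: "W \<in> borel_measurable M"
      unfolding W_def[abs_def] by (intro borel_measurable_prod Fm) auto
    have Wb: "cmod (W \<omega>) \<le> 1" for \<omega>
      unfolding W_def prod_norm[symmetric]
      by (rule prod_le_1) (auto simp: F_def indicator_def simp del: of_real_mult)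
    have upd: "expectation (\<lambda>\<omega>. W \<omega> * iexp (u * Z j \<omega>)) = K * char (distr M borel (Z j)) u" for u
    proof -
      have "(\<Prod>i\<in>I. F J S (s(j := u)) i \<omega>) = W \<omega> * iexp (u * Z j \<omega>)" for \<omega>
        unfolding prod.remove[OF I(1) j] W_def using insert.hyps(2)
        by (subst mult.commute, intro arg_cong2[where f="(*)"] prod.cong) (auto simp: F_def)
      moreover have "(\<Prod>i\<in>I. G J S (s(j := u)) i) = K * char (distr M borel (Z j)) u"
        unfolding prod.remove[OF I(1) j] K_def using insert.hyps(2)
        by (subst mult.commute, intro arg_cong2[where f="(*)"] prod.cong) (auto simp: G_def)
      ultimately show ?thesis using insert.IH[OF J, of "s(j := u)"] by (simp only:)
    qed
    \<comment> \<open>A characteristic function equals 1 at 0, so \<open>u = 0\<close> identifies \<open>K\<close> as the mean weight.\<close>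
    have EW: "expectation W = K"
      using upd[of 0] real_distribution.char_zero[OF real_distribution_distr[OF Z[OF j]]] by simp
    have "expectation (\<lambda>\<omega>. W \<omega> * indicator (S j) (Z j \<omega>))
        = expectation W * of_real (prob (Z j -` S j \<inter> space M))"
      by (rule complex_weight_uncorrelated[OF Z[OF j] Wm Wb])
        (use upd EW that(2) j in auto)
    moreover have "(\<Prod>i\<in>I. F (insert j J) S s i \<omega>) = W \<omega> * indicator (S j) (Z j \<omega>)" for \<omega>
      unfolding prod.remove[OF I(1) j] W_def
      by (subst mult.commute, intro arg_cong2[where f="(*)"] prod.cong) (auto simp: F_def)
    moreover have "(\<Prod>i\<in>I. G (insert j J) S s i) = K * of_real (prob (Z j -` S j \<inter> space M))"
      unfolding prod.remove[OF I(1) j] K_def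
      by (subst mult.commute, intro arg_cong2[where f="(*)"] prod.cong) (auto simp: G_def)
    ultimately show ?case by (simp add: EW)
  qed
  have "prob (\<Inter>i\<in>I. Z i -` S i \<inter> space M) = (\<Prod>i\<in>I. prob (Z i -` S i \<inter> space M))"
    if S: "\<And>i. i \<in> I \<Longrightarrow> S i \<in> sets borel" for S
  proof -
    let ?T = "\<Inter>i\<in>I. Z i -` S i \<inter> space M"
    have T: "?T \<in> events"
      using I Z S by (intro sets.finite_INT measurable_sets) auto
    have "?T = {\<omega> \<in> space M. \<forall>i\<in>I. Z i \<omega> \<in> S i}" using I(2) by auto
    then have "(\<Prod>i\<in>I. indicator (S i) (Z i \<omega>)) = (of_real (indicator ?T \<omega>) :: complex)" if "\<omega> \<in> space M" for \<omega>
      using that I(1) by (simp only:) (auto simp: indicator_def intro!: prod_zero)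
    then have "expectation (\<lambda>\<omega>. \<Prod>i\<in>I. F I S s i \<omega>) = expectation (\<lambda>\<omega>. of_real (indicator ?T \<omega>) :: complex)" for s
      by (intro Bochner_Integration.integral_cong refl) (simp add: F_def)
    also have "\<dots> = of_real (prob ?T)"
      unfolding integral_complex_of_real Bochner_Integration.integral_indicator
      using sets.sets_into_space[OF T] by (simp only: Int_absorb2)
    finally have "of_real (prob ?T) = (of_real (\<Prod>i\<in>I. prob (Z i -` S i \<inter> space M)) :: complex)"
      using key[of I S "\<lambda>_. 0"] S by (simp add: G_def)
    then show ?thesis by (simp only: of_real_eq_iff)
  qed
  then show ?thesis
    using Z by (subst indep_vars_finite[OF I(2,1), where E="\<lambda>_. sets borel"])
      (auto simp: sets.sigma_sets_eq[of borel, simplified] sets.Int_stable[of borel] Pi_iff)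
qed

section \<open>Characteristic functions of Gaussian type\<close>

text \<open>A nonnegative additive function is monotone. Comparing \<open>N u\<close> with the two integers
  around it therefore traps \<open>N (g u - u * g 1)\<close> within \<open>g 1\<close> for every \<open>N\<close>.\<close>

lemma nonneg_additive_imp_linear:
  fixes g :: "real \<Rightarrow> real"
  assumes nn: "\<And>u. u \<ge> 0 \<Longrightarrow> g u \<ge> 0"
    and add: "\<And>u v. u \<ge> 0 \<Longrightarrow> v \<ge> 0 \<Longrightarrow> g (u + v) = g u + g v"
    and u: "u \<ge> 0"
  shows "g u = u * g 1"
proof -
  have mono: "g u \<le> g v" if "0 \<le> u" "u \<le> v" for u v
    using add[of u "v - u"] nn[of "v - u"] that by simp
  have mult: "g (real n * u) = real n * g u" if "u \<ge> 0" for n u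
  proof (induction n)
    case 0
    show ?case using add[of 0 0] by simp
  next
    case (Suc n)
    then show ?case using add[of u "real n * u"] that by (simp add: algebra_simps)
  qed
  have bound: "real N * \<bar>g u - u * g 1\<bar> \<le> g 1" for N
  proof -
    define k where "k = nat \<lfloor>real N * u\<rfloor>"
    have k: "real k \<le> real N * u" "real N * u \<le> real (Suc k)"
      using u by (auto simp: k_def) linarith+
    have "real k * g 1 \<le> real N * g u" "real N * g u \<le> real (Suc k) * g 1"
      using mono[OF _ k(1)] mono[OF _ k(2)] u mult[of 1 k] mult[of 1 "Suc k"] mult[OF u, of N] by auto
    moreover have "real k * g 1 \<le> real N * u * g 1" "real N * u * g 1 \<le> real (Suc k) * g 1"
      using k nn[of 1] by (auto intro!: mult_right_mono)
    ultimately have "\<bar>real N * g u - real N * u * g 1\<bar> \<le> g 1"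
      by (simp add: algebra_simps abs_le_iff)
    moreover have "real N * g u - real N * u * g 1 = real N * (g u - u * g 1)"
      by (simp add: algebra_simps)
    ultimately show ?thesis by (simp add: abs_mult)
  qed
  show ?thesis
  proof (rule ccontr)
    assume "g u \<noteq> u * g 1"
    then obtain N where "g 1 < real N * \<bar>g u - u * g 1\<bar>"
      using reals_Archimedean3[of "\<bar>g u - u * g 1\<bar>"] by auto
    with bound[of N] show False by simp
  qed
qed

text \<open>Setting \<open>y = 0\<close> shows that the characteristic function is even, hence real. In the
  variable \<open>u = x\<^sup>2\<close> the equation says that \<open>h u\<close> is multiplicative. It takes values in
  \<open>(0, 1]\<close>, so \<open>- ln (h u)\<close> is additive and nonnegative, hence linear.\<close>

lemma (in real_distribution) Maxwell_Herschel:
  assumes eq: "\<And>x y. char M (sqrt (x\<^sup>2 + y\<^sup>2)) = char M x * char M y"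
  obtains c where "c \<ge> 0" "\<And>x. char M x = of_real (exp (- c * x\<^sup>2))"
proof -
  have abs: "char M \<bar>x\<bar> = char M x" for x
    using eq[of x 0] char_zero by simp
  have "cnj (char M x) = char M (- x)" for x
    by (rule cnj_char)
  then have "cnj (char M x) = char M x" for x
    using abs[of x] abs[of "- x"] by simp
  then have real: "char M x = of_real (Re (char M x))" for x
    by (metis Reals_cnj_iff of_real_Re)
  define h where "h u = Re (char M (sqrt u))" for u
  have h: "char M (sqrt u) = of_real (h u)" for u using real by (simp add: h_def)
  have h_mult: "h (u + v) = h u * h v" if "u \<ge> 0" "v \<ge> 0" for u v
    using eq[of "sqrt u" "sqrt v"] that by (simp add: h flip: of_real_mult)
  have h0: "h 0 = 1" using h[of 0] char_zero by simp
  have h_le: "h u \<le> 1" for u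
    unfolding h_def using complex_Re_le_cmod cmod_char_le_1 order_trans by blast
  have h_nn: "h u \<ge> 0" if "u \<ge> 0" for u
    using h_mult[of "u/2" "u/2"] that by simp
  have h_ne: "h u \<noteq> 0" if "u \<ge> 0" for u
  proof
    \<comment> \<open>A zero propagates by halving to points that tend to 0, where the value is 1.\<close>
    assume "h u = 0"
    have z: "h (u / 2 ^ n) = 0" for n
    proof (induction n)
      case (Suc n)
      then show ?case using h_mult[of "u / 2 ^ Suc n" "u / 2 ^ Suc n"] that by simp
    qed (simp add: \<open>h u = 0\<close>)
    have "(\<lambda>n. u / 2 ^ n) \<longlonglongrightarrow> 0"
      by (rule LIMSEQ_divide_realpow_zero) simp
    then have "(\<lambda>n. sqrt (u / 2 ^ n)) \<longlonglongrightarrow> sqrt 0" by (rule tendsto_real_sqrt)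
    then have "(\<lambda>n. char M (sqrt (u / 2 ^ n))) \<longlonglongrightarrow> char M 0"
      using isCont_tendsto_compose[OF isCont_char] by fastforce
    then have "(\<lambda>n. 0 :: complex) \<longlonglongrightarrow> 1" by (simp add: h z char_zero)
    then show False using LIMSEQ_unique tendsto_const zero_neq_one by metis
  qed
  have h_pos: "h u > 0" if "u \<ge> 0" for u using h_nn[OF that] h_ne[OF that] by simp
  define g where "g u = - ln (h u)" for u
  have g_nn: "g u \<ge> 0" if "u \<ge> 0" for u using h_pos[OF that] h_le[of u] by (simp add: g_def)
  have g_lin: "g u = u * g 1" if "u \<ge> 0" for u
    by (rule nonneg_additive_imp_linear[OF g_nn _ that])
      (auto simp: g_def h_mult ln_mult h_ne)
  show ?thesis
  proof
    show "g 1 \<ge> 0" by (rule g_nn) simp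
    fix x
    have "char M x = char M (sqrt (x\<^sup>2))" using abs by simp
    also have "\<dots> = of_real (h (x\<^sup>2))" by (rule h)
    also have "\<dots> = of_real (exp (- g (x\<^sup>2)))" using h_pos[of "x\<^sup>2"] by (simp add: g_def)
    also have "\<dots> = of_real (exp (- g 1 * x\<^sup>2))" using g_lin[of "x\<^sup>2"] by (simp add: mult.commute)
    finally show "char M x = of_real (exp (- g 1 * x\<^sup>2))" .
  qed
qed

lemma (in prob_space) AE_zero_if_char_trivial:
  assumes Z[measurable]: "random_variable borel Z" and triv: "\<And>t. char (distr M borel Z) t = 1"
  shows "AE \<omega> in M. Z \<omega> = 0"
proof -
  have [measurable]: "random_variable borel (\<lambda>_. 0 :: real)" by simp
  have "char (distr M borel (\<lambda>_. 0)) t = 1" for t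
    by (subst char_distr_eq) (auto simp: prob_space)
  with triv have "distr M borel Z = distr M borel (\<lambda>_. 0)"
    by (intro Levy_uniqueness real_distribution_distr) (auto simp del: distr_const)
  moreover have "AE z in distr M borel (\<lambda>_. 0 :: real). z = 0"
    by (subst AE_distr_iff) auto
  ultimately have "AE z in distr M borel Z. z = 0" by (simp only:)
  then show ?thesis by (subst (asm) AE_distr_iff) auto
qed

lemma (in prob_space) distributed_normal_if_char:
  assumes Z[measurable]: "random_variable borel Z" and \<sigma>: "\<sigma> > 0"
    and ch: "\<And>t. char (distr M borel Z) t = of_real (exp (- (\<sigma> * t)\<^sup>2 / 2))"
  shows "distributed M lborel Z (normal_density 0 \<sigma>)"
proof -
  let ?N = "\<lambda>\<omega>. (Z \<omega> - 0) / \<sigma>"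
  have "char (distr M borel ?N) t = char std_normal_distribution t" for t
  proof -
    have "char (distr M borel ?N) t = char (distr M borel Z) (t / \<sigma>)"
      by (simp add: char_distr_eq)
    then show ?thesis using \<sigma> by (simp add: ch char_std_normal_distribution)
  qed
  then have "distr M borel ?N = std_normal_distribution"
    by (intro Levy_uniqueness real_dist_normal_dist) auto
  moreover have "distr M lborel ?N = distr M borel ?N"
    by (rule distr_cong) auto
  ultimately have "distributed M lborel ?N std_normal_density"
    by (simp add: distributed_def)
  then show ?thesis using normal_standard_normal_convert[OF \<sigma>, of Z 0] by simp
qed

section \<open>Removing the random shift\<close>

lemma statistic_eq_inner: "statistic X A Y B a b \<omega> = a \<bullet> X \<omega> + b \<bullet> Y \<omega> + A \<omega> + B \<omega>"
  by (simp add: statistic_def inner_vec_def)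

lemma (in prob_space) char_vanishing_perturbation:
  assumes U[measurable]: "random_variable borel U" and R[measurable]: "random_variable borel R"
  shows "(\<lambda>n. char (distr M borel (\<lambda>\<omega>. U \<omega> + R \<omega> / real (Suc n))) t)
           \<longlonglongrightarrow> char (distr M borel U) t"
proof -
  have "(\<lambda>n. expectation (\<lambda>\<omega>. iexp (t * (U \<omega> + R \<omega> / real (Suc n)))))
      \<longlonglongrightarrow> expectation (\<lambda>\<omega>. iexp (t * U \<omega>))"
  proof (rule integral_dominated_convergence[where w="\<lambda>_. 1"])
    have "(\<lambda>n. U \<omega> + R \<omega> / real (Suc n)) \<longlonglongrightarrow> U \<omega>" for \<omega>
      using tendsto_add[OF tendsto_const LIMSEQ_Suc[OF lim_const_over_n]] by fastforce
    then show "AE \<omega> in M. (\<lambda>n. iexp (t * (U \<omega> + R \<omega> / real (Suc n)))) \<longlonglongrightarrow> iexp (t * U \<omega>)"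
      by (intro AE_I2 tendsto_intros)
  qed (auto simp del: of_real_mult of_real_add)
  then show ?thesis by (simp add: char_distr_eq)
qed

text \<open>The factor \<open>real (Suc n)\<close> in the coefficients is undone by evaluating the characteristic
  function of the statistic at \<open>1 / real (Suc n)\<close>, which scales the shift \<open>A + B\<close> down to 0 as \<open>n\<close>
  grows. Equality of the two sides holds for every \<open>n\<close> and is kept in the limit.\<close>

lemma (in prob_space) char_linear_part_radial:
  fixes X :: "'a \<Rightarrow> real ^ 'm" and Y :: "'a \<Rightarrow> real ^ 'n"
  assumes [measurable]: "random_variable borel X" "random_variable borel Y"
      "random_variable borel A" "random_variable borel B"
    and inv: "\<And>a b a' b'. (norm a)\<^sup>2 + (norm b)\<^sup>2 = (norm a')\<^sup>2 + (norm b')\<^sup>2 \<Longrightarrow>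
           distr M borel (statistic X A Y B a b) = distr M borel (statistic X A Y B a' b')"
    and eq: "(norm s)\<^sup>2 + (norm r)\<^sup>2 = (norm s')\<^sup>2 + (norm r')\<^sup>2"
  shows "char (distr M borel (\<lambda>\<omega>. s \<bullet> X \<omega> + r \<bullet> Y \<omega>)) 1
       = char (distr M borel (\<lambda>\<omega>. s' \<bullet> X \<omega> + r' \<bullet> Y \<omega>)) 1"
proof -
  define P where "P n s r = char (distr M borel (\<lambda>\<omega>. (s \<bullet> X \<omega> + r \<bullet> Y \<omega>) + (A \<omega> + B \<omega>) / real (Suc n))) 1"
    for n s r
  have stat: "P n s r = char (distr M borel (statistic X A Y B (real (Suc n) *\<^sub>R s) (real (Suc n) *\<^sub>R r))) (1 / real (Suc n))"
    for n s r
  proof -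
    let ?S = "statistic X A Y B (real (Suc n) *\<^sub>R s) (real (Suc n) *\<^sub>R r)"
      and ?L = "\<lambda>\<omega>. (s \<bullet> X \<omega> + r \<bullet> Y \<omega>) + (A \<omega> + B \<omega>) / real (Suc n)"
    have S: "random_variable borel ?S"
      unfolding statistic_eq_inner[abs_def] by measurable
    have L: "random_variable borel ?L" by measurable
    have "1 / real (Suc n) * ?S \<omega> = 1 * ?L \<omega>" for \<omega>
      by (simp add: statistic_eq_inner field_simps del: of_nat_Suc)
    then show ?thesis
      unfolding P_def char_distr_eq[OF S] char_distr_eq[OF L] by (simp only:)
  qed
  have "P n s r = P n s' r'" for n
    unfolding stat by (subst inv[of _ _ "real (Suc n) *\<^sub>R s'" "real (Suc n) *\<^sub>R r'"])
      (use eq in \<open>auto simp: power_mult_distrib simp flip: distrib_left\<close>)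
  moreover have lim: "(\<lambda>n. P n s r) \<longlonglongrightarrow> char (distr M borel (\<lambda>\<omega>. s \<bullet> X \<omega> + r \<bullet> Y \<omega>)) 1" for s r
    unfolding P_def by (rule char_vanishing_perturbation) auto
  ultimately show ?thesis using LIMSEQ_unique[OF lim[of s r]] lim[of s' r'] by simp
qed

section \<open>Independence of the two vectors and the normal law\<close>

text \<open>Used to discard \<open>A\<close> and \<open>B\<close> and to pass from the two vectors to the real variables
  \<open>s \<bullet> X\<close> and \<open>r \<bullet> Y\<close>, for which both notions of independence coincide.\<close>

lemma (in prob_space) indep_rv_compose:
  assumes ind: "indep_rv M N1 U N2 V" and f: "f \<in> measurable N1 N1'" and g: "g \<in> measurable N2 N2'"
  shows "indep_rv M N1' (\<lambda>\<omega>. f (U \<omega>)) N2' (\<lambda>\<omega>. g (V \<omega>))"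
proof -
  have U: "U \<in> measurable M N1" and V: "V \<in> measurable M N2"
    and ev: "indep_set {U -` S \<inter> space M | S. S \<in> sets N1} {V -` S \<inter> space M | S. S \<in> sets N2}"
    using ind by (simp_all add: indep_rv_def)
  have "{(\<lambda>\<omega>. f (U \<omega>)) -` S \<inter> space M | S. S \<in> sets N1'} \<subseteq> {U -` S \<inter> space M | S. S \<in> sets N1}"
  proof safe
    fix S assume "S \<in> sets N1'"
    then show "\<exists>T. (\<lambda>\<omega>. f (U \<omega>)) -` S \<inter> space M = U -` T \<inter> space M \<and> T \<in> sets N1"
      using measurable_space[OF U] f by (intro exI[of _ "f -` S \<inter> space N1"]) auto
  qed
  moreover have "{(\<lambda>\<omega>. g (V \<omega>)) -` S \<inter> space M | S. S \<in> sets N2'} \<subseteq> {V -` S \<inter> space M | S. S \<in> sets N2}"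
  proof safe
    fix S assume "S \<in> sets N2'"
    then show "\<exists>T. (\<lambda>\<omega>. g (V \<omega>)) -` S \<inter> space M = V -` T \<inter> space M \<and> T \<in> sets N2"
      using measurable_space[OF V] g by (intro exI[of _ "g -` S \<inter> space N2"]) auto
  qed
  ultimately have "indep_set {(\<lambda>\<omega>. f (U \<omega>)) -` S \<inter> space M | S. S \<in> sets N1'}
      {(\<lambda>\<omega>. g (V \<omega>)) -` S \<inter> space M | S. S \<in> sets N2'}"
    using ev unfolding indep_set_def by (elim indep_sets_mono_sets) (auto split: bool.split)
  then show ?thesis
    using measurable_compose[OF U f] measurable_compose[OF V g] by (simp add: indep_rv_def)
qed

theorem theorem2p1:
  fixes M :: "'w measure"
    and X :: "'w \<Rightarrow> real ^ 'm" and A :: "'w \<Rightarrow> real"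
    and Y :: "'w \<Rightarrow> real ^ 'n" and B :: "'w \<Rightarrow> real"
  assumes "prob_space M"
    and "indep_rv M borel (\<lambda>\<omega>. (X \<omega>, A \<omega>)) borel (\<lambda>\<omega>. (Y \<omega>, B \<omega>))"
    and "\<And>i. nondegenerate M (\<lambda>\<omega>. X \<omega> $ i)"
    and "\<And>j. nondegenerate M (\<lambda>\<omega>. Y \<omega> $ j)"
    and "\<And>a b a' b'. (norm a)\<^sup>2 + (norm b)\<^sup>2 = (norm a')\<^sup>2 + (norm b')\<^sup>2 \<Longrightarrow>
           distr M borel (statistic X A Y B a b) = distr M borel (statistic X A Y B a' b')"
  shows "prob_space.indep_vars M (\<lambda>_. borel)
           (case_sum (\<lambda>i \<omega>. X \<omega> $ i) (\<lambda>j \<omega>. Y \<omega> $ j)) (UNIV :: ('m + 'n) set)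
       \<and> (\<exists>\<sigma>>0. (\<forall>i. distributed M lborel (\<lambda>\<omega>. X \<omega> $ i) (normal_density 0 \<sigma>))
               \<and> (\<forall>j. distributed M lborel (\<lambda>\<omega>. Y \<omega> $ j) (normal_density 0 \<sigma>)))"
proof -
  interpret prob_space M by fact
  have XA: "random_variable (borel \<Otimes>\<^sub>M borel) (\<lambda>\<omega>. (X \<omega>, A \<omega>))"
    and YB: "random_variable (borel \<Otimes>\<^sub>M borel) (\<lambda>\<omega>. (Y \<omega>, B \<omega>))"
    using assms(2) by (simp_all add: indep_rv_def borel_prod)
  have [measurable]: "random_variable borel X" "random_variable borel A"
      "random_variable borel Y" "random_variable borel B"
    using measurable_compose[OF XA measurable_fst] measurable_compose[OF XA measurable_snd]
      measurable_compose[OF YB measurable_fst] measurable_compose[OF YB measurable_snd] by simp_all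
  have [measurable]: "random_variable borel (\<lambda>\<omega>. X \<omega> $ i)" "random_variable borel (\<lambda>\<omega>. Y \<omega> $ j)" for i j
    by (auto intro!: borel_measurable_continuous_on[where f="\<lambda>x. x $ _"] continuous_intros)
  define \<Psi> where "\<Psi> s r = char (distr M borel (\<lambda>\<omega>. s \<bullet> X \<omega> + r \<bullet> Y \<omega>)) 1" for s r
  define \<chi>X where "\<chi>X s = char (distr M borel (\<lambda>\<omega>. s \<bullet> X \<omega>)) 1" for s
  define \<chi>Y where "\<chi>Y r = char (distr M borel (\<lambda>\<omega>. r \<bullet> Y \<omega>)) 1" for r
  have radial: "\<Psi> s r = \<Psi> s' r'" if "(norm s)\<^sup>2 + (norm r)\<^sup>2 = (norm s')\<^sup>2 + (norm r')\<^sup>2" for s r s' r'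
    unfolding \<Psi>_def by (rule char_linear_part_radial[OF _ _ _ _ assms(5) that]) measurable
  have factor: "\<Psi> s r = \<chi>X s * \<chi>Y r" for s r
  proof -
    have "indep_rv M borel (\<lambda>\<omega>. s \<bullet> fst (X \<omega>, A \<omega>)) borel (\<lambda>\<omega>. r \<bullet> fst (Y \<omega>, B \<omega>))"
      by (rule indep_rv_compose[OF assms(2)])
        (auto intro!: borel_measurable_continuous_onI continuous_intros)
    then have "indep_var borel (\<lambda>\<omega>. s \<bullet> X \<omega>) borel (\<lambda>\<omega>. r \<bullet> Y \<omega>)"
      by (simp add: indep_rv_iff_indep_var)
    then show ?thesis unfolding \<Psi>_def \<chi>X_def \<chi>Y_def by (rule char_distr_add)
  qed
  have \<chi>0: "\<chi>X 0 = 1" "\<chi>Y 0 = 1"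
    by (simp_all add: \<chi>X_def \<chi>Y_def char_distr_eq prob_space del: distr_const)
  have char_X: "char (distr M borel (\<lambda>\<omega>. X \<omega> $ i)) t = \<chi>X (t *\<^sub>R axis i 1)" for i t
    by (simp add: \<chi>X_def char_distr_eq inner_axis')
  have char_Y: "char (distr M borel (\<lambda>\<omega>. Y \<omega> $ j)) t = \<chi>Y (t *\<^sub>R axis j 1)" for j t
    by (simp add: \<chi>Y_def char_distr_eq inner_axis')
  \<comment> \<open>Any component of \<open>X\<close> can serve as the reference law; index types are nonempty.\<close>
  define i0 :: 'm where "i0 = undefined"
  define \<phi> where "\<phi> = char (distr M borel (\<lambda>\<omega>. X \<omega> $ i0))"
  have \<Psi>: "\<Psi> s r = \<phi> (sqrt ((norm s)\<^sup>2 + (norm r)\<^sup>2))" for s r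
  proof -
    have "\<Psi> s r = \<Psi> (sqrt ((norm s)\<^sup>2 + (norm r)\<^sup>2) *\<^sub>R axis i0 1) 0"
      by (rule radial) simp
    then show ?thesis by (simp add: factor \<chi>0 \<phi>_def char_X)
  qed
  have \<chi>X: "\<chi>X s = \<phi> (norm s)" for s using \<Psi>[of s 0] by (simp add: factor \<chi>0)
  have \<chi>Y: "\<chi>Y r = \<phi> (norm r)" for r using \<Psi>[of 0 r] by (simp add: factor \<chi>0)
  have \<phi>_abs: "\<phi> \<bar>x\<bar> = \<phi> x" for x
    using char_X[of i0 x] by (simp add: \<phi>_def[symmetric] \<chi>X)
  interpret X0: real_distribution "distr M borel (\<lambda>\<omega>. X \<omega> $ i0)"
    by (rule real_distribution_distr) simp
  have "\<phi> (sqrt (x\<^sup>2 + y\<^sup>2)) = \<phi> x * \<phi> y" for x y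
  proof -
    have "\<phi> (sqrt (x\<^sup>2 + y\<^sup>2)) = \<Psi> (x *\<^sub>R axis i0 1) (y *\<^sub>R axis undefined 1)"
      by (simp add: \<Psi>)
    also have "\<dots> = \<phi> x * \<phi> y" by (simp add: factor \<chi>X \<chi>Y \<phi>_abs)
    finally show ?thesis .
  qed
  then obtain c where c: "c \<ge> 0" "\<And>x. \<phi> x = of_real (exp (- c * x\<^sup>2))"
    using X0.Maxwell_Herschel unfolding \<phi>_def by metis
  have "c \<noteq> 0"
  proof
    assume "c = 0"
    then have "AE \<omega> in M. X \<omega> $ i0 = 0"
      by (intro AE_zero_if_char_trivial) (simp_all add: c flip: \<phi>_def)
    then show False using assms(3)[of i0] by (auto simp: nondegenerate_def)
  qed
  \<comment> \<open>The characteristic function \<open>exp (- c * t\<^sup>2)\<close> belongs to the centred normal law of variance \<open>2 * c\<close>.\<close>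
  define \<sigma> where "\<sigma> = sqrt (2 * c)"
  have \<sigma>: "\<sigma> > 0" using c(1) \<open>c \<noteq> 0\<close> by (simp add: \<sigma>_def)
  have \<sigma>2: "(\<sigma> * t)\<^sup>2 / 2 = c * t\<^sup>2" for t using c(1) by (simp add: \<sigma>_def power_mult_distrib)
  have gauss_X: "char (distr M borel (\<lambda>\<omega>. X \<omega> $ i)) t = of_real (exp (- c * t\<^sup>2))" for i t
    by (simp add: char_X \<chi>X c)
  have gauss_Y: "char (distr M borel (\<lambda>\<omega>. Y \<omega> $ j)) t = of_real (exp (- c * t\<^sup>2))" for j t
    by (simp add: char_Y \<chi>Y c)
  let ?Z = "case_sum (\<lambda>i \<omega>. X \<omega> $ i) (\<lambda>j \<omega>. Y \<omega> $ j) :: 'm + 'n \<Rightarrow> 'w \<Rightarrow> real"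
  have "indep_vars (\<lambda>_. borel) ?Z UNIV"
  proof (rule Kac_indep_vars)
    show Z: "random_variable borel (?Z k)" for k by (cases k) auto
    fix u :: "'m + 'n \<Rightarrow> real"
    define s where "s = (\<chi> i. u (Inl i))"
    define r where "r = (\<chi> j. u (Inr j))"
    have "(\<Sum>k\<in>UNIV. u k * ?Z k \<omega>) = s \<bullet> X \<omega> + r \<bullet> Y \<omega>" for \<omega>
      by (simp add: UNIV_Plus_UNIV[symmetric] sum.Plus inner_vec_def s_def r_def del: UNIV_Plus_UNIV)
    then have "expectation (\<lambda>\<omega>. iexp (\<Sum>k\<in>UNIV. u k * ?Z k \<omega>)) = \<Psi> s r"
      by (simp add: \<Psi>_def char_distr_eq)
    also have "\<dots> = of_real (exp (- c * ((norm s)\<^sup>2 + (norm r)\<^sup>2)))"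
      by (simp add: \<Psi> c)
    also have "(norm s)\<^sup>2 + (norm r)\<^sup>2 = (\<Sum>k\<in>UNIV. (u k)\<^sup>2)"
      unfolding power2_norm_eq_inner inner_vec_def
      by (simp add: UNIV_Plus_UNIV[symmetric] sum.Plus s_def r_def power2_eq_square del: UNIV_Plus_UNIV)
    also have "of_real (exp (- c * (\<Sum>k\<in>UNIV. (u k)\<^sup>2))) = (\<Prod>k\<in>UNIV. of_real (exp (- c * (u k)\<^sup>2)))"
      by (simp add: sum_distrib_left exp_sum flip: sum_negf)
    also have "\<dots> = (\<Prod>k\<in>UNIV. char (distr M borel (?Z k)) (u k))"
    proof (rule prod.cong[OF refl])
      fix k
      show "of_real (exp (- c * (u k)\<^sup>2)) = char (distr M borel (?Z k)) (u k)"
        by (cases k) (simp_all only: sum.case gauss_X gauss_Y)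
    qed
    finally show "expectation (\<lambda>\<omega>. iexp (\<Sum>k\<in>UNIV. u k * ?Z k \<omega>))
        = (\<Prod>k\<in>UNIV. char (distr M borel (?Z k)) (u k))" .
  qed auto
  moreover have "distributed M lborel (\<lambda>\<omega>. X \<omega> $ i) (normal_density 0 \<sigma>)" for i
    by (rule distributed_normal_if_char[OF _ \<sigma>]) (simp_all add: gauss_X \<sigma>2)
  moreover have "distributed M lborel (\<lambda>\<omega>. Y \<omega> $ j) (normal_density 0 \<sigma>)" for j
    by (rule distributed_normal_if_char[OF _ \<sigma>]) (simp_all add: gauss_Y \<sigma>2)
  ultimately show ?thesis using \<sigma> by (intro conjI exI[of _ \<sigma>] allI)
qed

end
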